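(* Let $\Gamma \cup \{\varphi\} \subseteq \mathfrak{F}_{\{\neg\}}$. Then $\Gamma \vdash_{\{\neg\}} \varphi$ if and only if $\Gamma \vDash_{\mathbf{3}} \varphi$.
   Context: Let $\Pi$ be an infinite set of propositional letters. $\mathfrak{F}_{\{\neg\}}$ is the set of formulas built from $\Pi$ using only the unary connective $\neg$. Derivability $\vdash_{\{\neg\}}$ is the smallest relation between sets of formulas of $\mathfrak{F}_{\{\neg\}}$ and formulas of $\mathfrak{F}_{\{\neg\}}$ satisfying: (R$_\in$) if $\varphi \in \Gamma$, then $\Gamma \vdash \varphi$; (R$_m$) if $\Gamma \vdash \varphi$, then $\Gamma, \psi \vdash \varphi$; (R$_t$) if $\Gamma \vdash \varphi$ and $\Delta, \varphi \vdash \psi$, then $\Gamma, \Delta \vdash \psi$; (R$_{\neg I}$) if $\Gamma, \varphi \vdash \psi$ and $\Gamma, \varphi \vdash \neg\psi$, then $\Gamma \vdash \neg\varphi$; (R$_{\neg E}$) if $\Gamma \vdash \varphi$ and $\Gamma \vdash \neg\varphi$, then $\Gamma \vdash \psi$. $\mathbf{3}$ is the algebra $\langle \{0,\tfrac12,1\}; \neg\rangle$ with $\neg 0 = 1$ and $\neg\tfrac12 = \neg 1 = 0$, with set of designated values $D = \{1\}$. $\Gamma \vDash_{\mathbf{3}} \varphi$ means: for every assignment $v : \Pi \to \{0,\tfrac12,1\}$, with unique homomorphic extension $\bar v : \mathfrak{F}_{\{\neg\}} \to \{0,\tfrac12,1\}$, if $\bar v(\psi) = 1$ for all $\psi \in \Gamma$,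 then $\bar v(\varphi) = 1$. *)

theory Defs
  imports Main
begin

datatype 'p form = Atom 'p | Neg "'p form"

inductive derives :: "'p form set \<Rightarrow> 'p form \<Rightarrow> bool"  (infix "\<turnstile>" 50) where
  R_in: "\<phi> \<in> \<Gamma> \<Longrightarrow> \<Gamma> \<turnstile> \<phi>"
| R_m: "\<Gamma> \<turnstile> \<phi> \<Longrightarrow> insert \<psi> \<Gamma> \<turnstile> \<phi>"
| R_t: "\<Gamma> \<turnstile> \<phi> \<Longrightarrow> insert \<phi> \<Delta> \<turnstile> \<psi> \<Longrightarrow> \<Gamma> \<union> \<Delta> \<turnstile> \<psi>"
| R_negI: "insert \<phi> \<Gamma> \<turnstile> \<psi> \<Longrightarrow> insert \<phi> \<Gamma> \<turnstile> Neg \<psi> \<Longrightarrow> \<Gamma> \<turnstile> Neg \<phi>"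
| R_negE: "\<Gamma> \<turnstile> \<phi> \<Longrightarrow> \<Gamma> \<turnstile> Neg \<phi> \<Longrightarrow> \<Gamma> \<turnstile> \<psi>"

datatype three = Zero | Half | One

primrec neg3 :: "three \<Rightarrow> three" where
  "neg3 Zero = One"
| "neg3 Half = Zero"
| "neg3 One = Zero"

definition designated :: "three set" where
  "designated = {One}"

primrec extension :: "('p \<Rightarrow> three) \<Rightarrow> 'p form \<Rightarrow> three" where
  "extension v (Atom p) = v p"
| "extension v (Neg \<phi>) = neg3 (extension v \<phi>)"

definition entails3 :: "'p form set \<Rightarrow> 'p form \<Rightarrow> bool"  (infix "\<Turnstile>\<^sub>3" 50) where
  "\<Gamma> \<Turnstile>\<^sub>3 \<phi> \<longleftrightarrow>
    (\<forall>v :: 'p \<Rightarrow> three.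
      (\<forall>\<psi>\<in>\<Gamma>. extension v \<psi> \<in> designated) \<longrightarrow> extension v \<phi> \<in> designated)"

end

theory Submission imports Defs begin

text \<open>
  The two directions rest on two observations about the three-element algebra.

  Soundness is delicate only for negation introduction: if \<open>\<Gamma>, \<phi>\<close> is
  contradictory, then \<open>\<phi>\<close> is not designated in any model of \<open>\<Gamma>\<close>, but it could still
  have the value \<open>Half\<close>, and then its negation would not be designated either. This
  cannot happen, because the map that identifies \<open>Half\<close> with \<open>One\<close> is an endomorphism of
  the algebra: composed with a model of \<open>\<Gamma>\<close> it is again a model of \<open>\<Gamma>\<close>, and it now
  designates \<open>\<phi>\<close> (\<open>extension_collapse\<close>, \<open>entails3_negI\<close>).

  For completeness, up to provable equivalence an atom \<open>p\<close> generates only \<open>p\<close>,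
  \<open>\<not>p\<close> and \<open>\<not>\<not>p\<close>, and different atoms never interact. Hence a consistent set \<open>\<Gamma>\<close>
  need not be enlarged to a maximal one: the three values of \<open>p\<close> record directly
  whether \<open>\<Gamma>\<close> derives \<open>p\<close>, only \<open>\<not>\<not>p\<close>, or neither, and this valuation is a model of
  \<open>\<Gamma>\<close> (\<open>canonical_models\<close>). It refutes every atom that \<open>\<Gamma>\<close> does not derive. An
  underivable negation \<open>\<not>\<psi>\<close> is refuted by the canonical model of \<open>\<Gamma>, \<psi>\<close>, which is
  consistent by negation introduction.
\<close>

primrec collapse :: "three \<Rightarrow> three" where
  "collapse Zero = Zero"
| "collapse Half = One"
| "collapse One = One"

text \<open>
  \<open>collapse\<close> commutes with \<open>neg3\<close>, since \<open>Half\<close> and \<open>One\<close> have the same negation; its image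
  is the two-element Boolean subalgebra.
\<close>

lemma extension_collapse: "extension (collapse \<circ> v) \<phi> = collapse (extension v \<phi>)"
proof (induction \<phi>)
  case (Neg \<phi>)
  then show ?case by (cases "extension v \<phi>") auto
qed simp

lemma entails3_iff:
  "\<Gamma> \<Turnstile>\<^sub>3 \<phi> \<longleftrightarrow> (\<forall>v. (\<forall>\<psi>\<in>\<Gamma>. extension v \<psi> = One) \<longrightarrow> extension v \<phi> = One)"
  by (simp add: entails3_def designated_def)

lemma entails3_negI:
  assumes "insert \<phi> \<Gamma> \<Turnstile>\<^sub>3 \<psi>" and "insert \<phi> \<Gamma> \<Turnstile>\<^sub>3 Neg \<psi>"
  shows "\<Gamma> \<Turnstile>\<^sub>3 Neg \<phi>"
  unfolding entails3_iff
proof (intro allI impI)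
  fix v assume models: "\<forall>\<psi>\<in>\<Gamma>. extension v \<psi> = One"
  have "extension v \<phi> = Zero"
  proof (rule ccontr)
    assume "extension v \<phi> \<noteq> Zero"
    \<comment> \<open>The value may be \<open>Half\<close>, so the hypotheses are applied to the collapsed valuation.\<close>
    then have "extension (collapse \<circ> v) \<phi> = One"
      by (cases "extension v \<phi>") (simp_all add: extension_collapse)
    moreover have "\<forall>\<psi>\<in>\<Gamma>. extension (collapse \<circ> v) \<psi> = One"
      using models by (simp add: extension_collapse)
    ultimately have "extension (collapse \<circ> v) \<psi> = One"
      and "extension (collapse \<circ> v) (Neg \<psi>) = One"
      using assms unfolding entails3_iff by blast+
    then show False by simp
  qed
  then show "extension v (Neg \<phi>) = One" by simp
qed

lemma soundness: "\<Gamma> \<turnstile> \<phi> \<Longrightarrow> \<Gamma> \<Turnstile>\<^sub>3 \<phi>"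
proof (induction rule: derives.induct)
  case (R_negI \<phi> \<Gamma> \<psi>)
  then show ?case by (blast intro: entails3_negI)
next
  case (R_negE \<Gamma> \<phi> \<psi>)
  then show ?case by (fastforce simp: entails3_iff)
qed (auto simp: entails3_iff)

definition consistent :: "'p form set \<Rightarrow> bool" where
  "consistent \<Gamma> \<longleftrightarrow> (\<exists>\<phi>. \<not> \<Gamma> \<turnstile> \<phi>)"

lemma consistentD: "consistent \<Gamma> \<Longrightarrow> \<Gamma> \<turnstile> \<phi> \<Longrightarrow> \<not> \<Gamma> \<turnstile> Neg \<phi>"
  unfolding consistent_def by (blast intro: R_negE)

lemma consistent_insert: "\<not> \<Gamma> \<turnstile> Neg \<phi> \<Longrightarrow> consistent (insert \<phi> \<Gamma>)"
  unfolding consistent_def by (blast intro: R_negI)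

lemma double_negI: "\<phi> \<in> \<Gamma> \<Longrightarrow> \<Gamma> \<turnstile> Neg (Neg \<phi>)"
  by (rule R_negI[where \<psi> = \<phi>]) (auto intro: R_in)

lemma triple_negE:
  assumes "\<Gamma> \<turnstile> Neg (Neg (Neg \<phi>))"
  shows "\<Gamma> \<turnstile> Neg \<phi>"
proof (rule R_negI)
  show "insert \<phi> \<Gamma> \<turnstile> Neg (Neg \<phi>)" by (simp add: double_negI)
  show "insert \<phi> \<Gamma> \<turnstile> Neg (Neg (Neg \<phi>))" using assms by (rule R_m)
qed

definition canonical :: "'p form set \<Rightarrow> 'p \<Rightarrow> three" where
  "canonical \<Gamma> p =
    (if \<Gamma> \<turnstile> Atom p then One
     else if \<Gamma> \<turnstile> Neg (Neg (Atom p)) then Half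
     else Zero)"

text \<open>
  Derivable formulas must be shown to have the value \<open>One\<close>. Passing through a negation
  calls for \<open>Zero\<close> at formulas with a derivable negation; passing through a second one
  calls for a nonzero value at formulas with a derivable double negation, where \<open>Half\<close>
  has to be allowed. Since triple negations reduce to single ones, the induction closes
  with these three claims.
\<close>

lemma canonical_values:
  assumes "consistent \<Gamma>"
  shows "(\<Gamma> \<turnstile> \<phi> \<longrightarrow> extension (canonical \<Gamma>) \<phi> = One) \<and>
    (\<Gamma> \<turnstile> Neg \<phi> \<longrightarrow> extension (canonical \<Gamma>) \<phi> = Zero) \<and>
    (\<Gamma> \<turnstile> Neg (Neg \<phi>) \<longrightarrow> extension (canonical \<Gamma>) \<phi> \<noteq> Zero)"
proof (induction \<phi>)
  case (Atom p)
  then show ?case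
    using consistentD[OF assms, of "Atom p"] consistentD[OF assms, of "Neg (Atom p)"]
    by (auto simp: canonical_def)
next
  case (Neg \<phi>)
  then show ?case
    using triple_negE[of \<Gamma> \<phi>] by (cases "extension (canonical \<Gamma>) \<phi>") auto
qed

lemma canonical_models:
  assumes "consistent \<Gamma>" and "\<phi> \<in> \<Gamma>"
  shows "extension (canonical \<Gamma>) \<phi> = One"
  using canonical_values[OF assms(1)] R_in[OF assms(2)] by blast

lemma completeness:
  assumes "\<Gamma> \<Turnstile>\<^sub>3 \<phi>"
  shows "\<Gamma> \<turnstile> \<phi>"
proof (rule ccontr)
  assume underivable: "\<not> \<Gamma> \<turnstile> \<phi>"
  show False
  proof (cases \<phi>)
    case (Atom p)
    have "consistent \<Gamma>"
      using underivable by (auto simp: consistent_def)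
    then have "extension (canonical \<Gamma>) \<phi> = One"
      using assms canonical_models unfolding entails3_iff by blast
    then show False
      using underivable Atom by (simp add: canonical_def split: if_splits)
  next
    case (Neg \<psi>)
    then have "consistent (insert \<psi> \<Gamma>)"
      using underivable by (simp add: consistent_insert)
    then have models: "\<forall>\<chi>\<in>insert \<psi> \<Gamma>. extension (canonical (insert \<psi> \<Gamma>)) \<chi> = One"
      using canonical_models by blast
    then have "extension (canonical (insert \<psi> \<Gamma>)) (Neg \<psi>) = One"
      using assms Neg unfolding entails3_iff by blast
    then show False using models by simp
  qed
qed

theorem proposition8:
  fixes \<Gamma> :: "'p form set" and \<phi> :: "'p form"
  assumes "infinite (UNIV :: 'p set)"
  shows "\<Gamma> \<turnstile> \<phi> \<longleftrightarrow> \<Gamma> \<Turnstile>\<^sub>3 \<phi>"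
  using soundness completeness by blast

end
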